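(* Let $q = p^s$ be a power of a prime number $p$ and let $m > 1$ be an integer. Then there exists a positive integer $j$ such that $$p^j \equiv -1 \pmod{\operatorname{Rad}\left(\frac{q^m-1}{q-1}\right)}$$ if and only if $m = 2$, or $q = p$ is a Mersenne prime and $m = 4$. In the latter case ($q = p$ a Mersenne prime and $m=4$), the congruence holds precisely for those $j$ of the form $j = 2k$ with $k \geq 1$ odd.
   Context: For a positive integer $n$, $\operatorname{Rad}(n)$ is the product of all the distinct prime factors of $n$, with $\operatorname{Rad}(1)=1$. A Mersenne prime is a prime of the form $2^\ell - 1$ with $\ell$ prime. *)

theory Defs
  imports "HOL-Number_Theory.Number_Theory"
begin

definition Rad :: "nat \<Rightarrow> nat" where
  "Rad n = \<Prod>(prime_factors n)"

definition mersenne_prime :: "nat \<Rightarrow> bool" where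
  "mersenne_prime n \<longleftrightarrow> prime n \<and> (\<exists>l. prime l \<and> n = 2 ^ l - 1)"

text \<open>For q > 1 the truncated subtractions and the natural-number division
  in \<open>(q ^ m - 1) div (q - 1)\<close> are exact:\<close>

lemma quotient_exact:
  fixes q m :: nat
  shows "(q - 1) dvd (q ^ m - 1)"
proof (cases "q = 0")
  case True
  then show ?thesis by (cases m) auto
next
  case False
  then have "[q = 1] (mod (q - 1))"
    by (simp add: cong_altdef_nat)
  then have "[q ^ m = 1] (mod (q - 1))"
    using cong_pow by fastforce
  then show ?thesis using False by (simp add: cong_altdef_nat)
qed

end

theory Submission
  imports Defs
begin

text \<open>
  Write \<open>N = 1 + q + \<dots> + q\<^bsup>m-1\<^esup>\<close>.  For \<open>m = 2\<close> this is \<open>p\<^bsup>s\<^esup> + 1\<close>, and \<open>j = s\<close> will do.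
  Let now \<open>m > 2\<close>.  Since \<open>Rad N\<close> is squarefree, the congruence says that
  every prime \<open>r\<close> dividing \<open>N\<close> divides \<open>p\<^bsup>j\<^esup> + 1\<close>.  If \<open>r\<close> is odd, the exponents
  \<open>a\<close> with \<open>p\<^bsup>a\<^esup> \<equiv> -1 (mod r)\<close> all have the same 2-adic valuation, namely one
  less than that of the order of \<open>p\<close> modulo \<open>r\<close>
  (\<open>minus_one_exponents_same_valuation\<close>).  So the 2-adic valuation of \<open>j\<close> can be read off
  from any odd prime divisor of \<open>N\<close>, and the proof consists in finding two odd prime divisors
  which disagree.

  If \<open>m\<close> has an odd divisor \<open>u > 1\<close>, then \<open>N\<close> has an odd prime divisor modulo which \<open>p\<close> has
  odd order, so that no power of \<open>p\<close> is \<open>-1\<close> at all.  Such a prime is usually taken from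
  Zsigmondy's theorem, but it is enough to take a prime factor of the odd number
  \<open>1 + x + \<dots> + x\<^bsup>u-1\<^esup>\<close> with \<open>x = p\<^bsup>d\<^esup>\<close>, where \<open>d\<close> is the odd part of \<open>s\<close>: this number
  divides \<open>N\<close>, because for odd \<open>u\<close> replacing \<open>x\<close> by \<open>x\<^sup>2\<close> only adds factors
  (\<open>repunit_dvd_repunit_square\<close>).

  Otherwise \<open>m\<close> is a power of 2.  If \<open>4\<close> divides \<open>m\<close>, then \<open>(q + 1) (q\<^sup>2 + 1)\<close> divides \<open>N\<close>.
  The number \<open>q\<^sup>2 + 1\<close> has an odd prime divisor because it exceeds 2 and is not divisible by 4;
  this forces the valuation of \<open>j\<close> to be that of \<open>2 s\<close>.  An odd prime divisor of \<open>q + 1\<close> would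
  force that of \<open>s\<close>, and, when \<open>8\<close> divides \<open>m\<close>, one of \<open>q\<^sup>4 + 1\<close> would force that of \<open>4 s\<close>.
  Hence \<open>m = 4\<close> and \<open>q + 1\<close> is a power of 2, which makes \<open>q = p\<close> a Mersenne prime.  In that
  case \<open>Rad N\<close> divides \<open>p\<^sup>2 + 1\<close>, so that \<open>p\<^sup>2 \<equiv> -1 (mod Rad N)\<close>, and the valuation
  of an admissible \<open>j\<close> is 1.
\<close>

section \<open>Radicals and congruences to minus one\<close>

lemma Rad_dvd_iff:
  assumes "n > 0"
  shows "Rad n dvd y \<longleftrightarrow> (\<forall>r. prime r \<longrightarrow> r dvd n \<longrightarrow> r dvd y)"
proof
  assume "Rad n dvd y"
  moreover have "r dvd Rad n" if "prime r" "r dvd n" for r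
    unfolding Rad_def using that assms by (intro dvd_prod_eqI[of _ r]) (auto simp: in_prime_factors_iff)
  ultimately show "\<forall>r. prime r \<longrightarrow> r dvd n \<longrightarrow> r dvd y"
    using dvd_trans by blast
next
  assume "\<forall>r. prime r \<longrightarrow> r dvd n \<longrightarrow> r dvd y"
  then show "Rad n dvd y"
    unfolding Rad_def cong_0_iff[symmetric]
    by (intro coprime_cong_prod_nat[where m = "\<lambda>x. x"])
      (auto simp: in_prime_factors_iff cong_0_iff intro: primes_coprime)
qed

lemma cong_minus_one_iff_dvd:
  "[int p ^ j = -1] (mod int n) \<longleftrightarrow> n dvd p ^ j + 1"
proof -
  have "int (p ^ j + 1) = int p ^ j - (-1)"
    by simp
  then show ?thesis
    by (metis cong_iff_dvd_diff int_dvd_int_iff)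
qed

text \<open>
  With \<open>d\<close> odd, \<open>p\<^bsup>j d\<^esup>\<close> would be both \<open>1\<close> and \<open>-1\<close>.
\<close>

lemma no_minus_one_if_odd_order:
  fixes p r :: nat
  assumes "r > 2" and "odd d" and "[int p ^ d = 1] (mod int r)"
  shows "\<not> r dvd p ^ j + 1"
proof
  assume "r dvd p ^ j + 1"
  then have "[int p ^ j = -1] (mod int r)"
    by (simp add: cong_minus_one_iff_dvd)
  then have "[(int p ^ j) ^ d = (-1) ^ d] (mod int r)"
    by (rule cong_pow)
  moreover have "[(int p ^ d) ^ j = 1 ^ j] (mod int r)"
    using assms(3) by (rule cong_pow)
  ultimately have "[(1::int) = -1] (mod int r)"
    using \<open>odd d\<close> by (metis cong_sym cong_trans power_commutes power_mult
        mult.commute power_one uminus_power_if)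
  then have "int r dvd 2"
    by (simp add: cong_iff_dvd_diff)
  then show False
    using \<open>r > 2\<close> zdvd_imp_le by fastforce
qed

text \<open>
  Suppose the valuation \<open>\<alpha>\<close> of \<open>a\<close> is smaller than the valuation \<open>\<beta>\<close> of \<open>b\<close>.  The odd
  multiple of \<open>b\<close> by the odd part of \<open>a\<close> is then an even multiple of \<open>a\<close>, and the two
  descriptions give the values \<open>-1\<close> and \<open>1\<close> for the same power of \<open>p\<close>.
\<close>

lemma minus_one_exponents_same_valuation:
  fixes p r a b :: nat
  assumes "r > 2" and "a > 0" and "b > 0" and "r dvd p ^ a + 1" and "r dvd p ^ b + 1"
  shows "multiplicity 2 a = multiplicity 2 b"
proof -
  have not_less: "\<not> multiplicity 2 a < multiplicity 2 b"
    if "a > 0" "b > 0" "r dvd p ^ a + 1" "r dvd p ^ b + 1" for a b :: nat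
  proof
    assume less: "multiplicity 2 a < multiplicity 2 b"
    define \<alpha> where "\<alpha> = multiplicity 2 a"
    obtain a' where a': "a = 2 ^ \<alpha> * a'" "odd a'"
      using multiplicity_decompose'[of a 2] \<open>a > 0\<close> by (auto simp: \<alpha>_def)
    obtain e where e: "b = 2 ^ Suc \<alpha> * e"
      using less by (metis \<alpha>_def dvd_def multiplicity_dvd' Suc_leI)
    have "b * a' = a * (2 * e)"
      unfolding e by (subst a'(1)) simp
    then have "(int p ^ b) ^ a' = (int p ^ a) ^ (2 * e)"
      by (simp flip: power_mult)
    moreover have "[(int p ^ a) ^ (2 * e) = (-1) ^ (2 * e)] (mod int r)"
      using that by (intro cong_pow) (simp add: cong_minus_one_iff_dvd)
    ultimately have "[(int p ^ b) ^ a' = 1] (mod int r)"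
      by simp
    then have "[int p ^ (b * a') = 1] (mod int r)"
      by (simp add: power_mult)
    moreover have "[(int p ^ b) ^ a' = (-1) ^ a'] (mod int r)"
      using that by (intro cong_pow) (simp add: cong_minus_one_iff_dvd)
    then have "[int p ^ (b * a') = -1] (mod int r)"
      using a'(2) by (simp add: power_mult)
    ultimately have "[(1::int) = -1] (mod int r)"
      using cong_sym cong_trans by blast
    then have "int r dvd 2"
      by (simp add: cong_iff_dvd_diff)
    then show False
      using \<open>r > 2\<close> zdvd_imp_le by fastforce
  qed
  show ?thesis
    using not_less[of a b] not_less[of b a] assms(2-5) by simp
qed

section \<open>Powers of two\<close>

lemma odd_prime_divisor_or_power_of_2:
  fixes n :: nat
  assumes "n > 0"
  shows "(\<exists>r. prime r \<and> r > 2 \<and> r dvd n) \<or> (\<exists>t. n = 2 ^ t)"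
proof -
  obtain u where u: "n = 2 ^ multiplicity 2 n * u" "odd u"
    using multiplicity_decompose'[of n 2] assms by auto
  show ?thesis
  proof (cases "u = 1")
    case False
    then obtain r where r: "prime r" "r dvd u"
      using prime_factor_nat by blast
    moreover have "r \<noteq> 2"
      using r u by auto
    then have "r > 2"
      using prime_ge_2_nat[OF \<open>prime r\<close>] by simp
    ultimately show ?thesis
      using u(1) by (metis dvd_mult)
  qed (use u in auto)
qed

lemma square_plus_1_not_power_of_2:
  fixes x :: nat
  assumes "x > 1"
  shows "x ^ 2 + 1 \<noteq> 2 ^ t"
proof
  assume eq: "x ^ 2 + 1 = 2 ^ t"
  have "x ^ 2 > 1"
    using assms by (intro one_less_power) auto
  then have "t \<ge> 2"
    using eq by (cases t; cases "t - 1") auto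
  then have "4 dvd x ^ 2 + 1"
    using eq le_imp_power_dvd[of 2 t "2::nat"] by simp
  moreover have "\<not> 4 dvd x ^ 2 + 1"
  proof (cases "even x")
    case True
    then obtain y where "x = 2 * y" ..
    then have "x ^ 2 + 1 = 4 * y ^ 2 + 1"
      by (simp add: power2_eq_square)
    then show ?thesis
      by presburger
  next
    case False
    then obtain y where "x = 2 * y + 1" ..
    then have "x ^ 2 + 1 = 4 * (y ^ 2 + y) + 2"
      by (simp add: power2_eq_square algebra_simps)
    then show ?thesis
      by presburger
  qed
  ultimately show False
    by simp
qed

lemma square_plus_1_odd_prime_divisor:
  fixes x :: nat
  assumes "x > 1"
  obtains r where "prime r" "r > 2" "r dvd x ^ 2 + 1"
  using odd_prime_divisor_or_power_of_2[of "x ^ 2 + 1"] square_plus_1_not_power_of_2[OF assms]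
  by auto

section \<open>Repunits\<close>

definition repunit :: "'a::comm_semiring_1 \<Rightarrow> nat \<Rightarrow> 'a" where
  "repunit x m = (\<Sum>i<m. x ^ i)"

lemma repunit_Suc: "repunit x (Suc m) = repunit x m + x ^ m"
  by (simp add: repunit_def)

lemma repunit_0: "repunit x 0 = 0"
  by (simp add: repunit_def)

lemma repunit_of_nat: "repunit (of_nat x) m = of_nat (repunit x m)"
  by (simp add: repunit_def)

lemma repunit_pos: "m > 0 \<Longrightarrow> repunit (x::nat) m > 0"
  by (cases "m = 1") (auto simp: repunit_def intro!: sum_pos2[of _ 0])

lemma repunit_ring: "(x - 1) * repunit x m = x ^ m - (1::'a::comm_ring_1)"
  by (induction m) (simp_all add: repunit_0 repunit_Suc algebra_simps)

lemma repunit_nat: "(x - 1) * repunit x m = x ^ m - (1::nat)" if "x > 0"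
proof -
  have "x ^ m > 0"
    using that by simp
  then have "int ((x - 1) * repunit x m) = int (x ^ m - 1)"
    using that repunit_ring[of "int x" m] by (simp add: of_nat_diff repunit_of_nat)
  then show ?thesis
    by linarith
qed

lemma quotient_eq_repunit: "(x ^ m - 1) div (x - 1) = repunit x m" if "(x::nat) > 1"
  using repunit_nat[of x m] that by (metis div_mult_self1_is_m less_trans zero_less_diff zero_less_one)

lemma repunit_mult: "repunit x (k * n) = repunit x k * repunit (x ^ k) n"
proof (induction n)
  case (Suc n)
  have add: "repunit x (a + b) = repunit x a + x ^ a * repunit x b" for a b
    by (induction b) (simp_all add: repunit_0 repunit_Suc algebra_simps power_add)
  have "repunit x (k * Suc n) = repunit x (k * n) + x ^ (k * n) * repunit x k"
    by (simp add: add add.commute flip: add[of "k * n" k])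
  then show ?case
    using Suc by (simp add: repunit_Suc algebra_simps power_mult)
qed (simp add: repunit_0)

lemma repunit_dvd: "k dvd m \<Longrightarrow> repunit x k dvd repunit x m"
  by (auto simp: repunit_mult)

lemma repunit_2: "repunit x 2 = x + 1"
  by (simp add: repunit_def numeral_2_eq_2 add.commute)

lemma repunit_4: "repunit x 4 = (x + 1) * (x ^ 2 + 1)"
  using repunit_mult[of x 2 2] by (simp add: repunit_2)

lemma repunit_8: "repunit x 8 = (x + 1) * (x ^ 2 + 1) * (x ^ 4 + 1)"
  using repunit_mult[of x 4 2] by (simp add: repunit_2 repunit_4)

lemma odd_repunit:
  fixes x :: "'a :: {comm_semiring_1, semiring_parity}"
  assumes "odd m"
  shows "odd (repunit x m)"
proof (cases "even x")
  case True
  have "odd (repunit x (Suc n))" for n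
    by (induction n) (use True in \<open>auto simp: repunit_Suc repunit_0\<close>)
  then show ?thesis
    using assms by (metis odd_pos Suc_pred)
next
  case False
  have "odd (repunit x n) \<longleftrightarrow> odd n" for n
    by (induction n) (use False in \<open>auto simp: repunit_Suc repunit_0\<close>)
  then show ?thesis
    using assms by simp
qed

text \<open>The classical factorization of \<open>x\<^bsup>m\<^esup> + 1\<close> for odd \<open>m\<close>; it lives over the integers
  because the cofactor is an alternating sum.\<close>

lemma plus_1_times_repunit_uminus:
  fixes x :: int
  assumes "odd m"
  shows "(x + 1) * repunit (- x) m = x ^ m + 1"
  using repunit_ring[of "- x" m] assms by (simp add: algebra_simps)

text \<open>Counting the powers of \<open>x\<close> below \<open>2 m\<close> in two ways gives
  \<open>(x + 1) repunit (x\<^sup>2) m = repunit x m (x\<^bsup>m\<^esup> + 1)\<close>, and for odd \<open>m\<close> the last factor is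
  itself a multiple of \<open>x + 1\<close>.\<close>

lemma repunit_dvd_repunit_square:
  fixes x :: nat
  assumes "odd m"
  shows "repunit x m dvd repunit (x ^ 2) m"
proof -
  let ?x = "int x"
  have "(?x + 1) * repunit (?x ^ 2) m = repunit ?x m * (?x ^ m + 1)"
    using repunit_mult[of ?x 2 m] repunit_mult[of ?x m 2] by (simp add: repunit_2 mult.commute)
  also have "\<dots> = (?x + 1) * (repunit ?x m * repunit (- ?x) m)"
    by (simp flip: plus_1_times_repunit_uminus[OF assms])
  finally have "repunit (?x ^ 2) m = repunit ?x m * repunit (- ?x) m"
    by simp
  then have "int (repunit x m) dvd int (repunit (x ^ 2) m)"
    by (metis dvd_triv_left of_nat_power repunit_of_nat)
  then show ?thesis
    by simp
qed

text \<open>Halving \<open>s\<close> while it is even passes to divisors, by the preceding lemma.  Once \<open>s\<close> is odd,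
  the odd number \<open>d = s u\<close> serves as the exponent: any prime factor of the odd
  number \<open>repunit (p\<^bsup>s\<^esup>) u\<close> divides \<open>p\<^bsup>s u\<^esup> - 1\<close>.\<close>

lemma repunit_prime_divisor_of_odd_order:
  fixes p s u :: nat
  assumes "p > 1" and "s > 0" and "odd u" and "u > 1"
  shows "\<exists>r d. prime r \<and> r > 2 \<and> r dvd repunit (p ^ s) u \<and> odd d \<and> [int p ^ d = 1] (mod int r)"
  using \<open>s > 0\<close>
proof (induction s rule: less_induct)
  case (less s)
  show ?case
  proof (cases "even s")
    case True
    then obtain h where h: "s = h * 2"
      by (metis dvd_def mult.commute)
    then have "h < s" "h > 0"
      using less.prems by auto
    then obtain r d where rd: "prime r" "r > 2" "r dvd repunit (p ^ h) u" "odd d"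
        "[int p ^ d = 1] (mod int r)"
      using less.IH by blast
    moreover have "repunit (p ^ h) u dvd repunit (p ^ s) u"
      using repunit_dvd_repunit_square[OF \<open>odd u\<close>, of "p ^ h"] by (simp add: h power_mult)
    ultimately show ?thesis
      using dvd_trans by blast
  next
    case False
    let ?x = "p ^ s"
    have "?x > 1"
      using assms(1) less.prems by (intro one_less_power)
    have "repunit ?x u \<noteq> 1"
    proof
      assume "repunit ?x u = 1"
      moreover have "(?x - 1) * repunit ?x u = ?x ^ u - 1"
        using \<open>?x > 1\<close> by (intro repunit_nat) linarith
      ultimately have "?x - 1 = ?x ^ u - 1"
        by (simp only: mult_1_right)
      moreover have "?x < ?x ^ u"
        using power_strict_increasing[OF \<open>u > 1\<close> \<open>?x > 1\<close>] by (simp only: power_one_right)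
      ultimately show False
        using \<open>?x > 1\<close> by linarith
    qed
    then obtain r where r: "prime r" "r dvd repunit ?x u"
      using prime_factor_nat by blast
    moreover have "r \<noteq> 2"
      using r odd_repunit[OF \<open>odd u\<close>, of ?x] by auto
    then have "r > 2"
      using prime_ge_2_nat[OF r(1)] by simp
    moreover have "int r dvd int p ^ (s * u) - 1"
    proof -
      have "int r dvd repunit (int ?x) u"
        using r(2) by (simp add: repunit_of_nat del: of_nat_power)
      then have "int r dvd int ?x ^ u - 1"
        by (metis dvd_mult repunit_ring)
      then show ?thesis
        by (simp add: power_mult)
    qed
    then have "[int p ^ (s * u) = 1] (mod int r)"
      by (simp add: cong_iff_dvd_diff)
    ultimately show ?thesis
      using False \<open>odd u\<close> by (metis even_mult_iff)
  qed
qed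

section \<open>Mersenne primes\<close>

text \<open>The exponent of a Mersenne prime is prime because \<open>2\<^bsup>a\<^esup> - 1\<close> divides
  \<open>2\<^bsup>a b\<^esup> - 1\<close>.\<close>

lemma mersenne_primeI:
  fixes p t :: nat
  assumes "prime p" and "p + 1 = 2 ^ t"
  shows "mersenne_prime p"
proof -
  have p: "p = 2 ^ t - 1" "p \<ge> 2"
    using assms prime_ge_2_nat by (auto simp: algebra_simps)
  have "t > 1"
    using assms(2) p(2) by (cases t; cases "t - 1") auto
  moreover have "a = 1 \<or> a = t" if "a dvd t" for a
  proof -
    obtain b where b: "t = a * b"
      using \<open>a dvd t\<close> dvdE by blast
    have "2 ^ a - 1 dvd p"
      using repunit_nat[of "2 ^ a" b] by (metis b dvd_triv_left p(1) pos2 power_mult zero_less_power)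
    then have "2 ^ a - 1 = (1::nat) \<or> 2 ^ a - 1 = p"
      using \<open>prime p\<close> by (simp add: prime_nat_iff)
    then have "(2::nat) ^ a = 2 ^ 1 \<or> (2::nat) ^ a = 2 ^ t"
      using assms(2) by auto
    then show ?thesis
      by (simp only: power_inject_exp one_less_numeral_iff semiring_norm)
  qed
  ultimately have "prime t"
    by (auto simp: prime_nat_iff)
  then show ?thesis
    unfolding mersenne_prime_def using assms(1) p(1) by blast
qed

text \<open>For even \<open>s\<close> the number \<open>p\<^bsup>s\<^esup> + 1\<close> is a square plus one.  For odd \<open>s\<close> it is \<open>p + 1\<close> times
  an odd number, which can divide a power of 2 only if it is a unit.\<close>

lemma exponent_eq_1_if_plus_1_power_of_2:
  fixes p s t :: nat
  assumes "p > 1" and "s > 0" and "p ^ s + 1 = 2 ^ t"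
  shows "s = 1"
proof (cases "even s")
  case True
  then obtain h where h: "s = h * 2"
    by (metis dvd_def mult.commute)
  then have "p ^ h > 1"
    using assms by (intro one_less_power) auto
  then show ?thesis
    using square_plus_1_not_power_of_2[of "p ^ h" t] assms(3) by (simp add: h power_mult)
next
  case False
  let ?c = "repunit (- int p) s"
  have prod: "(int p + 1) * ?c = int (p ^ s + 1)"
    using plus_1_times_repunit_uminus[OF False, of "int p"] by simp
  then have "?c dvd 2 ^ t"
    using assms(3) by (metis dvd_triv_right of_nat_numeral of_nat_power)
  moreover have "coprime ?c (2 ^ t)"
    using odd_repunit[OF False, of "- int p"] by (simp add: coprime_right_2_iff_odd)
  ultimately have "is_unit ?c"
    using coprime_common_divisor[OF _ dvd_refl] by blast
  then have "?c = 1 \<or> ?c = -1"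
    by (auto simp: abs_eq_iff')
  moreover have "?c > 0"
    using zero_less_mult_pos[of "int p + 1" ?c] prod by linarith
  ultimately have "?c = 1"
    by linarith
  then have "p ^ s = p ^ 1"
    using prod by simp
  then show ?thesis
    using power_inject_exp[OF \<open>p > 1\<close>] by blast
qed

section \<open>The criterion\<close>

lemma cong_Rad_quotient_iff:
  fixes p q m j :: nat
  assumes "q > 1" and "m > 0"
  shows "[int p ^ j = -1] (mod int (Rad ((q ^ m - 1) div (q - 1))))
    \<longleftrightarrow> (\<forall>r. prime r \<longrightarrow> r dvd repunit q m \<longrightarrow> r dvd p ^ j + 1)"
  unfolding quotient_eq_repunit[OF \<open>q > 1\<close>] cong_minus_one_iff_dvd
  by (intro Rad_dvd_iff repunit_pos \<open>m > 0\<close>)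

lemma minus_one_power_imp:
  fixes p s m j :: nat
  assumes "prime p" and "s > 0" and "m > 1" and "j > 0"
    and all: "\<And>r. prime r \<Longrightarrow> r dvd repunit (p ^ s) m \<Longrightarrow> r dvd p ^ j + 1"
  shows "m = 2 \<or> s = 1 \<and> mersenne_prime p \<and> m = 4"
proof -
  let ?q = "p ^ s"
  have "p > 1"
    using \<open>prime p\<close> by (rule prime_gt_1_nat)
  then have "?q > 1"
    using \<open>s > 0\<close> by (intro one_less_power)
  \<comment> \<open>For \<open>k = 0, 1, 2\<close> this concerns the factors \<open>q + 1\<close>, \<open>q\<^sup>2 + 1\<close>, \<open>q\<^sup>4 + 1\<close> of \<open>N\<close>,
    modulo whose prime divisors \<open>p\<^bsup>2^k s\<^esup>\<close> is \<open>-1\<close>.\<close>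
  have valuation: "multiplicity 2 j = multiplicity 2 s + k"
    if "prime r" "r > 2" "r dvd repunit ?q m" "r dvd ?q ^ 2 ^ k + 1" for r k
  proof -
    have "r dvd p ^ (2 ^ k * s) + 1"
      using that(4) by (simp add: power_mult mult.commute)
    then have "multiplicity 2 j = multiplicity 2 (2 ^ k * s)"
      using that all \<open>j > 0\<close> \<open>s > 0\<close>
      by (intro minus_one_exponents_same_valuation[of r _ _ p]) auto
    also have "\<dots> = multiplicity 2 s + k"
      using \<open>s > 0\<close> by (subst prime_elem_multiplicity_mult_distrib) auto
    finally show ?thesis .
  qed
  obtain u where u: "m = 2 ^ multiplicity 2 m * u" "odd u"
    using multiplicity_decompose'[of m 2] \<open>m > 1\<close> by auto
  have "u = 1"
  proof (rule ccontr)
    assume "u \<noteq> 1"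
    then have "u > 1"
      using u(2) odd_pos[of u] by linarith
    then obtain r d where "prime r" "r > 2" "r dvd repunit ?q u" "odd d"
        "[int p ^ d = 1] (mod int r)"
      using repunit_prime_divisor_of_odd_order[OF \<open>p > 1\<close> \<open>s > 0\<close> u(2)] by blast
    moreover have "repunit ?q u dvd repunit ?q m"
      using u(1) by (intro repunit_dvd) (metis dvd_triv_right)
    ultimately show False
      using no_minus_one_if_odd_order all dvd_trans by metis
  qed
  then obtain a where m: "m = 2 ^ a"
    using u(1) by auto
  have "a > 0"
    using m \<open>m > 1\<close> by (cases a) auto
  show ?thesis
  proof (cases "a = 1")
    case True
    then show ?thesis
      using m by simp
  next
    case False
    then have "4 dvd m"
      using \<open>a > 0\<close> m le_imp_power_dvd[of 2 a "2::nat"] by simp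
    then have N4: "(?q + 1) * (?q ^ 2 + 1) dvd repunit ?q m"
      using repunit_dvd[of 4 m ?q] by (simp add: repunit_4)
    obtain r where r: "prime r" "r > 2" "r dvd ?q ^ 2 + 1"
      using square_plus_1_odd_prime_divisor[OF \<open>?q > 1\<close>] .
    have "r dvd repunit ?q m"
      using r(3) N4 by (meson dvd_mult dvd_trans)
    then have j: "multiplicity 2 j = multiplicity 2 s + 1"
      using valuation[of r 1] r by simp
    have "a = 2"
    proof (rule ccontr)
      assume "a \<noteq> 2"
      then have "8 dvd m"
        using False \<open>a > 0\<close> m le_imp_power_dvd[of 3 a "2::nat"] by simp
      then have N8: "(?q + 1) * (?q ^ 2 + 1) * (?q ^ 4 + 1) dvd repunit ?q m"
        using repunit_dvd[of 8 m ?q] by (simp add: repunit_8)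
      have "?q ^ 2 > 1"
        by (rule one_less_power[OF \<open>?q > 1\<close>]) simp
      then obtain r' where r': "prime r'" "r' > 2" "r' dvd (?q ^ 2) ^ 2 + 1"
        using square_plus_1_odd_prime_divisor by blast
      have four: "(?q ^ 2) ^ 2 = ?q ^ 4"
        using power_mult[of ?q 2 2] by simp
      then have "r' dvd repunit ?q m"
        using r'(3) N8 by (metis dvd_mult dvd_trans)
      then have "multiplicity 2 j = multiplicity 2 s + 2"
        using valuation[of r' 2] r' four by simp
      then show False
        using j by simp
    qed
    moreover have "\<not> (\<exists>r. prime r \<and> r > 2 \<and> r dvd ?q + 1)"
    proof
      assume "\<exists>r. prime r \<and> r > 2 \<and> r dvd ?q + 1"
      then obtain r' where r': "prime r'" "r' > 2" "r' dvd ?q + 1"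
        by blast
      then have "r' dvd repunit ?q m"
        using N4 by (meson dvd_mult2 dvd_trans)
      then have "multiplicity 2 j = multiplicity 2 s"
        using valuation[of r' 0] r' by simp
      then show False
        using j by simp
    qed
    then obtain t where t: "?q + 1 = 2 ^ t"
      using odd_prime_divisor_or_power_of_2[of "?q + 1"] by auto
    then have "s = 1"
      using exponent_eq_1_if_plus_1_power_of_2 \<open>p > 1\<close> \<open>s > 0\<close> by blast
    ultimately show ?thesis
      using m t mersenne_primeI[OF \<open>prime p\<close>, of t] by simp
  qed
qed

text \<open>For a Mersenne prime \<open>p\<close> the factor \<open>p + 1\<close> of \<open>repunit p 4\<close> contributes only the prime 2,
  which already divides \<open>p\<^sup>2 + 1\<close>.\<close>

lemma prime_dvd_repunit_4_mersenne:
  assumes "mersenne_prime p" and "prime r" and "r dvd repunit p 4"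
  shows "r dvd p ^ 2 + 1"
proof -
  obtain l where l: "prime l" "p = 2 ^ l - 1"
    using assms(1) mersenne_prime_def by blast
  have "p + 1 = 2 ^ l"
    using l(2) by simp
  then have "r dvd 2 ^ l * (p ^ 2 + 1)"
    using assms(3) by (simp add: repunit_4)
  then consider "r dvd 2 ^ l" | "r dvd p ^ 2 + 1"
    using \<open>prime r\<close> prime_dvd_mult_iff by blast
  then show ?thesis
  proof cases
    case 1
    then have "r = 2"
      using \<open>prime r\<close> prime_dvd_power primes_dvd_imp_eq two_is_prime_nat by blast
    moreover have "odd p"
      using l prime_gt_0_nat[OF l(1)] by simp
    ultimately show ?thesis
      by simp
  qed
qed

lemma mersenne_minus_one_power_iff:
  fixes p j :: nat
  assumes "mersenne_prime p" and "j > 0"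
  shows "(\<forall>r. prime r \<longrightarrow> r dvd repunit p 4 \<longrightarrow> r dvd p ^ j + 1)
    \<longleftrightarrow> (\<exists>k. k \<ge> 1 \<and> odd k \<and> j = 2 * k)"
proof
  assume all: "\<forall>r. prime r \<longrightarrow> r dvd repunit p 4 \<longrightarrow> r dvd p ^ j + 1"
  have "p > 1"
    using assms(1) prime_gt_1_nat by (auto simp only: mersenne_prime_def)
  then obtain r where r: "prime r" "r > 2" "r dvd p ^ 2 + 1"
    using square_plus_1_odd_prime_divisor by blast
  then have "r dvd p ^ j + 1"
    using all r by (metis dvd_mult repunit_4)
  then have "multiplicity 2 j = multiplicity 2 (2::nat)"
    using r \<open>j > 0\<close> by (intro minus_one_exponents_same_valuation[of r _ _ p]) auto
  then have "multiplicity 2 j = 1"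
    by simp
  then obtain k where "j = 2 * k" "odd k"
    using multiplicity_decompose'[of j 2] \<open>j > 0\<close> by auto
  then show "\<exists>k. k \<ge> 1 \<and> odd k \<and> j = 2 * k"
    using odd_pos[of k] by (intro exI[of _ k]) auto
next
  assume "\<exists>k. k \<ge> 1 \<and> odd k \<and> j = 2 * k"
  then obtain k where k: "odd k" "j = 2 * k"
    by blast
  show "\<forall>r. prime r \<longrightarrow> r dvd repunit p 4 \<longrightarrow> r dvd p ^ j + 1"
  proof (intro allI impI)
    fix r :: nat
    assume "prime r" "r dvd repunit p 4"
    then have "[int p ^ 2 = -1] (mod int r)"
      using prime_dvd_repunit_4_mersenne[OF assms(1)] cong_minus_one_iff_dvd by blast
    then have "[(int p ^ 2) ^ k = (-1) ^ k] (mod int r)"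
      by (rule cong_pow)
    then have "[int p ^ j = -1] (mod int r)"
      using k by (simp add: power_mult)
    then show "r dvd p ^ j + 1"
      by (simp add: cong_minus_one_iff_dvd)
  qed
qed

theorem proposition1p9:
  fixes p s q m :: nat
  assumes "prime p" and "s \<ge> 1" and "q = p ^ s" and "m > 1"
  shows "((\<exists>j::nat. j > 0 \<and> [int p ^ j = -1] (mod int (Rad ((q ^ m - 1) div (q - 1)))))
            \<longleftrightarrow> m = 2 \<or> (q = p \<and> mersenne_prime p \<and> m = 4))
         \<and> (q = p \<and> mersenne_prime p \<and> m = 4 \<longrightarrow>
              (\<forall>j::nat. j > 0 \<longrightarrow>
                ([int p ^ j = -1] (mod int (Rad ((q ^ m - 1) div (q - 1))))
                   \<longleftrightarrow> (\<exists>k::nat. k \<ge> 1 \<and> odd k \<and> j = 2 * k))))"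
proof -
  have "q > 1"
    unfolding \<open>q = p ^ s\<close> using assms by (intro one_less_power prime_gt_1_nat) auto
  then have cong_iff: "[int p ^ j = -1] (mod int (Rad ((q ^ m - 1) div (q - 1))))
      \<longleftrightarrow> (\<forall>r. prime r \<longrightarrow> r dvd repunit q m \<longrightarrow> r dvd p ^ j + 1)" for j
    using \<open>m > 1\<close> by (intro cong_Rad_quotient_iff) auto
  have mersenne: "(\<forall>r. prime r \<longrightarrow> r dvd repunit q m \<longrightarrow> r dvd p ^ j + 1)
      \<longleftrightarrow> (\<exists>k. k \<ge> 1 \<and> odd k \<and> j = 2 * k)"
    if "q = p \<and> mersenne_prime p \<and> m = 4" "j > 0" for j
    using that mersenne_minus_one_power_iff by simp
  have "m = 2 \<or> (q = p \<and> mersenne_prime p \<and> m = 4)"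
    if "j > 0" "\<forall>r. prime r \<longrightarrow> r dvd repunit q m \<longrightarrow> r dvd p ^ j + 1" for j
    using minus_one_power_imp[of p s m j] that assms by auto
  moreover have "\<exists>j>0. \<forall>r. prime r \<longrightarrow> r dvd repunit q m \<longrightarrow> r dvd p ^ j + 1"
    if "m = 2 \<or> (q = p \<and> mersenne_prime p \<and> m = 4)"
    using that
  proof
    assume "m = 2"
    then show ?thesis
      using assms by (intro exI[of _ s]) (auto simp: repunit_2)
  next
    assume "q = p \<and> mersenne_prime p \<and> m = 4"
    then show ?thesis
      using mersenne[of 2] by (intro exI[of _ 2]) force
  qed
  ultimately show ?thesis
    unfolding cong_iff using mersenne by blast
qed

end
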